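(* Consider the problem of scheduling with uncertain processing times on a single machine with the objective of minimizing the total completion time. For a job $k$ let $r_k$ denote $u_k/t_k$. The expected competitive ratio of the randomized algorithm $\beta$-RPCP with parameter $\beta>0$ is at most $$\max_k\ \frac{(1+\frac1\beta)\,u_k\,(1-\mathbb P_k)+\max\{2t_k+p_k,\ \beta t_k,\ (1+\frac1\beta)(t_k+p_k)\}\,\mathbb P_k}{p_k^*},$$ where $p_k^*=\min\{u_k,t_k+p_k\}$, the maximum is over jobs $k$, and the probability $\mathbb P_k$ with which the algorithm tests job $k$ is $$\mathbb P_k=\frac{(\beta+1)(r_k-1)}{\beta\left(\max\{\frac{2}{r_k}+1,\ \frac{\beta}{r_k},\ (1+\frac1\beta)(1+\frac1{r_k})\}-\max\{2,\ \beta,\ 1+\frac1\beta\}+r_k-1\right)+r_k-1}$$ if $r_k\in[1,3]$, $\mathbb P_k=0$ if $r_k<1$, and $\mathbb P_k=1$ if $r_k>3$.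
   Context: Problem. There are $n$ jobs, all available at time $0$. Job $j$ has a testing time $t_j$, an upper limit $u_j$, and a real processing time $p_j\in[0,u_j]$. A job may be executed untested, which takes $u_j$ time units, or it may be tested (taking $t_j$ time units) and later executed in $p_j$ time units; other tasks may run between the test and the execution. A single machine runs one task at a time. The completion time of a job is the time at which its execution (or execution-untested) ends, and the cost of a schedule is the sum of the completion times of all jobs. An online algorithm knows all $t_j,u_j$ from the start, but learns $p_j$ only when the test of $j$ is finished. $\mathrm{OPT}$ knows all $p_j$ in advance (but must still test $j$ in order to run it in time $p_j$), and its cost is the minimum cost of any schedule; it spends $p_j^*=\min\{u_j,t_j+p_j\}$ on job $j$. The expected competitive ratio of a randomized online algorithm $A$ is the smallest $c$ such that $\mathbb E[\mathrm{cost}(A)]\le c\cdot \mathrm{cost}(\mathrm{OPT})$ on all instances. Algorithm $\beta$-RPCP. Maintain a priority queue of tasks, smaller weight meaning higher priority. Initially, for each job $j$, choose at random: with probability $\mathbb P_j$ insert a testing task of weight $\beta t_j$ (job $j$ is tested), and with probability $1-\mathbb P_j$ insert an execution-untested task of weight $u_j$ (job $j$ is not tested). While the queue is nonempty, extract a task of smallest weight and run it; if it was the testing task of job $j$ (taking $t_j$ time), then after the test insert an execution task for $j$ with weight $t_j+p_j$ (running this execution task takes $p_j$ time).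
   Formalization: Only instances on which every P_k lies in [0,1] are covered; for β>2 the formula can leave [0,1] (e.g. β=4, r_k=1.1 gives P_k<0) and the algorithm is then undefined; for β≤2 nothing is excluded. Where the formula reads 0/0 (r_k=1, β≥3), P_k is taken as 0. *)

theory Defs
  imports "HOL-Probability.Probability"
begin

section \<open>Scheduling with testing on a single machine\<close>

record problem =
  num_jobs :: nat
  test_time :: "nat \<Rightarrow> real"
  upper_limit :: "nat \<Rightarrow> real"
  proc_time :: "nat \<Rightarrow> real"

abbreviation jobs :: "problem \<Rightarrow> nat set" where
  "jobs I \<equiv> {..<num_jobs I}"

text \<open>Positive testing times are what makes the quotient of upper limit and testing time
  meaningful, and at least one job is needed for a maximum over jobs to exist.\<close>

definition valid_problem :: "problem \<Rightarrow> bool" where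
  "valid_problem I \<longleftrightarrow> num_jobs I \<ge> 1 \<and>
     (\<forall>j\<in>jobs I. test_time I j > 0 \<and> 0 \<le> proc_time I j \<and> proc_time I j \<le> upper_limit I j)"

definition opt_time :: "problem \<Rightarrow> nat \<Rightarrow> real" where
  "opt_time I j = min (upper_limit I j) (test_time I j + proc_time I j)"

datatype task = Test nat | Exec nat | Exec_Untested nat

fun duration :: "problem \<Rightarrow> task \<Rightarrow> real" where
  "duration I (Test j) = test_time I j"
| "duration I (Exec j) = proc_time I j"
| "duration I (Exec_Untested j) = upper_limit I j"

text \<open>A schedule assigns a start time to each task that is run; idle time is allowed.\<close>

type_synonym schedule = "task \<rightharpoonup> real"

definition feasible :: "problem \<Rightarrow> schedule \<Rightarrow> bool" where
  "feasible I \<sigma> \<longleftrightarrow>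
     dom \<sigma> \<subseteq> (\<Union>j\<in>jobs I. {Test j, Exec j, Exec_Untested j}) \<and>
     (\<forall>j\<in>jobs I.
        (Exec_Untested j \<in> dom \<sigma> \<and> Test j \<notin> dom \<sigma> \<and> Exec j \<notin> dom \<sigma>) \<or>
        (Exec_Untested j \<notin> dom \<sigma> \<and> Test j \<in> dom \<sigma> \<and> Exec j \<in> dom \<sigma> \<and>
           the (\<sigma> (Test j)) + test_time I j \<le> the (\<sigma> (Exec j)))) \<and>
     (\<forall>a\<in>dom \<sigma>. 0 \<le> the (\<sigma> a)) \<and>
     (\<forall>a\<in>dom \<sigma>. \<forall>b\<in>dom \<sigma>. a \<noteq> b \<longrightarrow>
        the (\<sigma> a) + duration I a \<le> the (\<sigma> b) \<or> the (\<sigma> b) + duration I b \<le> the (\<sigma> a))"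

definition completion_time :: "problem \<Rightarrow> schedule \<Rightarrow> nat \<Rightarrow> real" where
  "completion_time I \<sigma> j =
     (if Exec_Untested j \<in> dom \<sigma> then the (\<sigma> (Exec_Untested j)) + upper_limit I j
      else the (\<sigma> (Exec j)) + proc_time I j)"

definition cost :: "problem \<Rightarrow> schedule \<Rightarrow> real" where
  "cost I \<sigma> = (\<Sum>j\<in>jobs I. completion_time I \<sigma> j)"

definition opt :: "problem \<Rightarrow> real" where
  "opt I = Inf {cost I \<sigma> |\<sigma>. feasible I \<sigma>}"

text \<open>The infimum over all (possibly infinite) competitive factors on a class of problems, for
  an algorithm given by its expected cost on each problem.\<close>

definition expected_competitive_ratio :: "(problem \<Rightarrow> real) \<Rightarrow> problem set \<Rightarrow> ereal" where
  "expected_competitive_ratio ecost \<P> =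
     Inf {c. \<forall>I\<in>\<P>. ereal (ecost I) \<le> c * ereal (opt I)}"


section \<open>The algorithm\<close>

fun weight :: "real \<Rightarrow> problem \<Rightarrow> task \<Rightarrow> real" where
  "weight \<beta> I (Test j) = \<beta> * test_time I j"
| "weight \<beta> I (Exec j) = test_time I j + proc_time I j"
| "weight \<beta> I (Exec_Untested j) = upper_limit I j"

fun released :: "task \<Rightarrow> task set" where
  "released (Test j) = {Exec j}"
| "released (Exec j) = {}"
| "released (Exec_Untested j) = {}"

text \<open>\<open>queue_run \<beta> I Q xs\<close>: starting with queue \<open>Q\<close>, the tasks may be run in the order \<open>xs\<close>.
  This is a relation because ties between smallest weights are broken arbitrarily.\<close>

inductive queue_run :: "real \<Rightarrow> problem \<Rightarrow> task set \<Rightarrow> task list \<Rightarrow> bool"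
  for \<beta> :: real and I :: problem where
  empty: "queue_run \<beta> I {} []"
| step: "x \<in> Q \<Longrightarrow> \<forall>y\<in>Q. weight \<beta> I x \<le> weight \<beta> I y \<Longrightarrow>
     queue_run \<beta> I (Q - {x} \<union> released x) xs \<Longrightarrow> queue_run \<beta> I Q (x # xs)"

fun back_to_back :: "problem \<Rightarrow> real \<Rightarrow> task list \<Rightarrow> schedule" where
  "back_to_back I now [] = Map.empty"
| "back_to_back I now (x # xs) = (back_to_back I (now + duration I x) xs)(x \<mapsto> now)"

text \<open>The argument \<open>c\<close> holds the outcomes of the coin flips: job \<open>j\<close> is tested iff \<open>c j\<close>.\<close>

definition initial_queue :: "problem \<Rightarrow> (nat \<Rightarrow> bool) \<Rightarrow> task set" where
  "initial_queue I c = (\<lambda>j. if c j then Test j else Exec_Untested j) ` jobs I"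

text \<open>\<open>A I c\<close> is the order in which the tasks are run; different \<open>A\<close> differ only in how they
  break ties.\<close>

definition is_RPCP :: "real \<Rightarrow> (problem \<Rightarrow> (nat \<Rightarrow> bool) \<Rightarrow> task list) \<Rightarrow> bool" where
  "is_RPCP \<beta> A \<longleftrightarrow>
     (\<forall>I c. valid_problem I \<longrightarrow> queue_run \<beta> I (initial_queue I c) (A I c))"

definition ratio :: "problem \<Rightarrow> nat \<Rightarrow> real" where
  "ratio I k = upper_limit I k / test_time I k"

definition test_prob_of_ratio :: "real \<Rightarrow> real \<Rightarrow> real" where
  "test_prob_of_ratio \<beta> r =
     (if r < 1 then 0
      else if r > 3 then 1
      else (\<beta> + 1) * (r - 1) /
        (\<beta> * (max (2 / r + 1) (max (\<beta> / r) ((1 + 1 / \<beta>) * (1 + 1 / r)))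
              - max 2 (max \<beta> (1 + 1 / \<beta>)) + r - 1) + r - 1))"

definition test_prob :: "real \<Rightarrow> problem \<Rightarrow> nat \<Rightarrow> real" where
  "test_prob \<beta> I k = test_prob_of_ratio \<beta> (ratio I k)"

text \<open>For \<open>\<beta> > 2\<close> the formula above can leave the unit interval, and then the algorithm is not
  defined; its denominator can also vanish (e.g. \<open>\<beta> \<ge> 3\<close>, \<open>r = 1\<close>), where division by zero yields the
  probability \<open>0\<close>. For \<open>0 < \<beta> \<le> 2\<close> there is no restriction, as the lemma shows.\<close>

definition RPCP_problems :: "real \<Rightarrow> problem set" where
  "RPCP_problems \<beta> =
     {I. valid_problem I \<and> (\<forall>k\<in>jobs I. 0 \<le> test_prob \<beta> I k \<and> test_prob \<beta> I k \<le> 1)}"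

lemma test_prob_of_ratio_in_unit:
  assumes "0 < \<beta>" "\<beta> \<le> 2"
  shows "0 \<le> test_prob_of_ratio \<beta> r" "test_prob_of_ratio \<beta> r \<le> 1"
proof -
  have "0 \<le> test_prob_of_ratio \<beta> r \<and> test_prob_of_ratio \<beta> r \<le> 1"
  proof (cases "1 \<le> r \<and> r \<le> 3")
    case True
    define a where "a = max (2 / r + 1) (max (\<beta> / r) ((1 + 1 / \<beta>) * (1 + 1 / r)))"
    define b where "b = max 2 (max \<beta> (1 + 1 / \<beta>))"
    have h1: "3 / 2 \<le> 1 + 1 / \<beta>" and h2: "4 / 3 \<le> 1 + 1 / r"
      using assms True by (simp_all add: field_simps)
    have "(3 / 2) * (4 / 3) \<le> (1 + 1 / \<beta>) * (1 + 1 / r)"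
      using mult_mono[OF h1 h2] h1 by auto
    moreover have "(1 + 1 / \<beta>) * 1 \<le> (1 + 1 / \<beta>) * (1 + 1 / r)"
      using h1 True by (intro mult_left_mono) auto
    ultimately have "b \<le> a"
      using assms by (auto simp: a_def b_def)
    then have nn: "0 \<le> \<beta> * (a - b)"
      using assms by simp
    have eq: "test_prob_of_ratio \<beta> r
        = (\<beta> + 1) * (r - 1) / (\<beta> * (a - b) + (\<beta> + 1) * (r - 1))"
      using True by (simp add: test_prob_of_ratio_def a_def b_def algebra_simps)
    have "0 \<le> (\<beta> + 1) * (r - 1)"
      using assms True by simp
    with nn show ?thesis
      unfolding eq by (auto simp: divide_le_eq_1)
  qed (auto simp: test_prob_of_ratio_def)
  then show "0 \<le> test_prob_of_ratio \<beta> r" "test_prob_of_ratio \<beta> r \<le> 1"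
    by auto
qed

lemma RPCP_problems_eq:
  assumes "0 < \<beta>" "\<beta> \<le> 2"
  shows "RPCP_problems \<beta> = {I. valid_problem I}"
  using test_prob_of_ratio_in_unit[OF assms] by (simp add: RPCP_problems_def test_prob_def)

definition expected_cost ::
    "real \<Rightarrow> (problem \<Rightarrow> (nat \<Rightarrow> bool) \<Rightarrow> task list) \<Rightarrow> problem \<Rightarrow> real" where
  "expected_cost \<beta> A I =
     measure_pmf.expectation
       (Pi_pmf (jobs I) False (\<lambda>j. bernoulli_pmf (test_prob \<beta> I j)))
       (\<lambda>c. cost I (back_to_back I 0 (A I c)))"

text \<open>If \<open>upper_limit I k = 0\<close> then this is \<open>0 / 0 = 0\<close>, and job \<open>k\<close> does not contribute to the
  maximum over all jobs.\<close>

definition job_ratio :: "real \<Rightarrow> problem \<Rightarrow> nat \<Rightarrow> real" where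
  "job_ratio \<beta> I k =
     ((1 + 1 / \<beta>) * upper_limit I k * (1 - test_prob \<beta> I k)
      + max (2 * test_time I k + proc_time I k)
          (max (\<beta> * test_time I k) ((1 + 1 / \<beta>) * (test_time I k + proc_time I k)))
        * test_prob \<beta> I k)
     / opt_time I k"

end

theory Submission
  imports Defs
begin

text \<open>The cost of a schedule is the sum, over all ordered pairs of jobs, of the time spent on the
  second job before the first one completes. For two distinct jobs \<open>j\<close> and \<open>k\<close> the two summands
  together are bounded by a quantity that depends only on \<open>k\<close> and its coin flip, whatever happens
  to \<open>j\<close>; the numerator of the ratio of job \<open>k\<close> is the expectation of this quantity. In each pair
  we apply this bound to the job with the smaller optimal time \<open>p\<^sup>*\<close>, and compare with the
  lower bound on the optimum in which every pair contributes the smaller of its optimal times.\<close>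

section \<open>Jobs and pairs of jobs\<close>

text \<open>Going from \<open>n\<close> to \<open>Suc n\<close> adds one row and one column, that
  is, one diagonal entry and one new pair for each smaller index. Both the cost of a run and the
  lower bound on the optimum are split this way.\<close>

lemma sum_square_pairs:
  fixes F :: "nat \<Rightarrow> nat \<Rightarrow> 'a::comm_monoid_add"
  shows "(\<Sum>j<n. \<Sum>k<n. F j k) = (\<Sum>j<n. F j j) + (\<Sum>j<n. \<Sum>k<j. F j k + F k j)"
  by (induction n) (simp_all add: sum.distrib ac_simps)

text \<open>The flag \<open>b\<close> says whether the job is tested. For the algorithm it is the
  coin flip; for an arbitrary schedule it is read off from the domain.\<close>

definition job_tasks :: "bool \<Rightarrow> nat \<Rightarrow> task set" where
  "job_tasks b k = (if b then {Test k, Exec k} else {Exec_Untested k})"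

definition final_task :: "bool \<Rightarrow> nat \<Rightarrow> task" where
  "final_task b k = (if b then Exec k else Exec_Untested k)"

definition job_time :: "problem \<Rightarrow> bool \<Rightarrow> nat \<Rightarrow> real" where
  "job_time I b k = (if b then test_time I k + proc_time I k else upper_limit I k)"

lemma finite_job_tasks [simp]: "finite (job_tasks b k)"
  by (simp add: job_tasks_def)

lemma job_tasks_disjoint: "j \<noteq> k \<Longrightarrow> job_tasks b j \<inter> job_tasks b' k = {}"
  by (auto simp: job_tasks_def)

lemma sum_job_tasks: "sum (duration I) (job_tasks b k) = job_time I b k"
  by (simp add: job_tasks_def job_time_def)

lemma final_task_in_job_tasks: "final_task b k \<in> job_tasks b k"
  by (simp add: job_tasks_def final_task_def)

lemma opt_time_le_job_time: "opt_time I k \<le> job_time I b k"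
  by (simp add: opt_time_def job_time_def)

lemma valid_problemD:
  assumes "valid_problem I" "k \<in> jobs I"
  shows "0 < test_time I k" "0 \<le> proc_time I k" "proc_time I k \<le> upper_limit I k"
    "0 \<le> upper_limit I k"
  using assms order_trans by (auto simp: valid_problem_def)

lemma opt_time_nonneg:
  assumes "valid_problem I" "k \<in> jobs I"
  shows "0 \<le> opt_time I k"
  using valid_problemD[OF assms] by (simp add: opt_time_def)

lemma duration_nonneg:
  assumes "valid_problem I" "k \<in> jobs I" "a \<in> job_tasks b k"
  shows "0 \<le> duration I a"
  using valid_problemD[OF assms(1,2)] assms(3) by (auto simp: job_tasks_def split: if_splits)

section \<open>A lower bound on the optimum\<close>

text \<open>Disjoint intervals inside \<open>[0, T]\<close> have total length at most
  \<open>T\<close>. Induction by start time: the others end before the latest one starts, so the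
  induction hypothesis applies with the start \<open>s x\<close> as the new horizon.\<close>

lemma sum_disjoint_durations_le:
  fixes s d :: "'a \<Rightarrow> real"
  assumes "finite S" "0 \<le> T"
    and "\<And>a. a \<in> S \<Longrightarrow> 0 \<le> s a" "\<And>a. a \<in> S \<Longrightarrow> 0 \<le> d a" "\<And>a. a \<in> S \<Longrightarrow> s a + d a \<le> T"
    and "\<And>a b. a \<in> S \<Longrightarrow> b \<in> S \<Longrightarrow> a \<noteq> b \<Longrightarrow> s a + d a \<le> s b \<or> s b + d b \<le> s a"
  shows "sum d S \<le> T"
proof -
  have main: "sum d S' \<le> T'"
    if "finite S'" "0 \<le> T'" "S' \<subseteq> S" "\<forall>a\<in>S'. 0 < d a \<and> s a + d a \<le> T'" for S' T'
    using that
  proof (induction S' arbitrary: T' rule: finite_ranking_induct[where f = s])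
    case empty
    then show ?case by simp
  next
    case (insert x S')
    show ?case
    \<comment> \<open>The ranking induction does not promise that \<open>x\<close> is a fresh
      element.\<close>
    proof (cases "x \<in> S'")
      case True
      then show ?thesis
        using insert.IH[of T'] insert.prems by (simp add: insert_absorb)
    next
      case False
      have "s b + d b \<le> s x" if "b \<in> S'" for b
      proof -
        have "s x + d x \<le> s b \<or> s b + d b \<le> s x"
          using assms(6)[of x b] that False insert.prems(2) by blast
        moreover have "s b \<le> s x" "0 < d x"
          using insert.hyps(2)[of b] that insert.prems(3) by auto
        ultimately show ?thesis by linarith
      qed
      then have "sum d S' \<le> s x"
        using insert.prems assms(3) by (intro insert.IH) auto
      then show ?thesis
        using insert.prems insert.hyps(1) False by fastforce
    qed
  qed
  \<comment> \<open>Tasks of length zero are removed first: if one starts together with a longer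
    task, the longer one need not end by that common start, which breaks the induction.\<close>
  have "sum d S = sum d {a\<in>S. 0 < d a}"
    using assms(1,4) by (intro sum.mono_neutral_right) force+
  also have "\<dots> \<le> T"
    using assms by (intro main) auto
  finally show ?thesis .
qed

text \<open>This is the cost of the shortest-processing-time-first order when job \<open>j\<close>
  takes time \<open>opt_time I j\<close>: in each pair the shorter job delays the longer
  one.\<close>

definition pair_bound :: "problem \<Rightarrow> real" where
  "pair_bound I = (\<Sum>j\<in>jobs I. opt_time I j)
     + (\<Sum>j\<in>jobs I. \<Sum>k<j. min (opt_time I j) (opt_time I k))"

text \<open>By the time job \<open>j\<close> completes, all tasks of every job completing no later
  have been run on the single machine, so the completion time of \<open>j\<close> is at least the
  sum of their optimal times. In every pair one job completes no later than the other and thus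
  contributes at least the minimum.\<close>

lemma feasible_cost_ge:
  assumes valid: "valid_problem I" and feas: "feasible I \<sigma>"
  shows "pair_bound I \<le> cost I \<sigma>"
proof -
  define c where "c k \<longleftrightarrow> Test k \<in> dom \<sigma>" for k
  define C where "C = completion_time I \<sigma>"
  define s where "s a = the (\<sigma> a)" for a
  have alt: "(\<not> c k \<and> Exec_Untested k \<in> dom \<sigma>) \<or>
      (c k \<and> Exec_Untested k \<notin> dom \<sigma> \<and> Exec k \<in> dom \<sigma> \<and>
        s (Test k) + test_time I k \<le> s (Exec k))"
    if "k \<in> jobs I" for k
    using conjunct1[OF conjunct2[OF feas[unfolded feasible_def]]] that
    unfolding c_def s_def by blast
  have tasks: "job_tasks (c k) k \<subseteq> dom \<sigma>" if "k \<in> jobs I" for k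
    using alt[OF that] by (auto simp: job_tasks_def c_def)
  have fin: "s a + duration I a \<le> C k" if k: "k \<in> jobs I" and a: "a \<in> job_tasks (c k) k" for a k
  proof -
    have "C k = (if c k then s (Exec k) + proc_time I k else s (Exec_Untested k) + upper_limit I k)"
      using alt[OF k] unfolding C_def completion_time_def s_def by metis
    then show ?thesis
      using alt[OF k] a valid_problemD(2)[OF valid k]
      by (auto simp: job_tasks_def split: if_splits)
  qed
  have start: "0 \<le> s a" if "a \<in> dom \<sigma>" for a
    using feas that unfolding feasible_def s_def by blast
  have sep: "s a + duration I a \<le> s b \<or> s b + duration I b \<le> s a"
    if "a \<in> dom \<sigma>" "b \<in> dom \<sigma>" "a \<noteq> b" for a b
    using feas that unfolding feasible_def s_def by blast
  have C_nonneg: "0 \<le> C k" if k: "k \<in> jobs I" for k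
  proof -
    let ?f = "final_task (c k) k"
    have f: "?f \<in> job_tasks (c k) k" by (rule final_task_in_job_tasks)
    then have "0 \<le> s ?f"
      using start tasks[OF k] by blast
    then show ?thesis
      using fin[OF k f] duration_nonneg[OF valid k f] by linarith
  qed
  \<comment> \<open>The share of job \<open>k\<close> in the completion time of \<open>j\<close>.
    Ties count in both directions, which only increases \<open>F j k + F k j\<close>.\<close>
  define F where "F j k = (if C k \<le> C j then opt_time I k else 0)" for j k
  have C_ge: "(\<Sum>k\<in>jobs I. F j k) \<le> C j" if j: "j \<in> jobs I" for j
  proof -
    let ?K = "{k\<in>jobs I. C k \<le> C j}"
    have "(\<Sum>k\<in>jobs I. F j k) = (\<Sum>k\<in>?K. opt_time I k)"
      unfolding F_def by (rule sum.inter_filter[symmetric]) simp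
    also have "\<dots> \<le> (\<Sum>k\<in>?K. sum (duration I) (job_tasks (c k) k))"
      by (intro sum_mono) (simp add: sum_job_tasks opt_time_le_job_time)
    also have "\<dots> = sum (duration I) (\<Union>k\<in>?K. job_tasks (c k) k)"
      by (rule sum.UNION_disjoint[symmetric]) (auto simp: job_tasks_disjoint)
    also have "\<dots> \<le> C j"
    proof (rule sum_disjoint_durations_le[where s = s])
      fix a assume "a \<in> (\<Union>k\<in>?K. job_tasks (c k) k)"
      then obtain k where k: "k \<in> jobs I" "C k \<le> C j" "a \<in> job_tasks (c k) k" by blast
      show "0 \<le> s a" using start tasks k by blast
      show "0 \<le> duration I a" using duration_nonneg valid k by blast
      show "s a + duration I a \<le> C j" using fin[OF k(1,3)] k(2) by linarith
    next
      fix a b assume "a \<in> (\<Union>k\<in>?K. job_tasks (c k) k)" "b \<in> (\<Union>k\<in>?K. job_tasks (c k) k)" "a \<noteq> b"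
      then show "s a + duration I a \<le> s b \<or> s b + duration I b \<le> s a"
        using tasks by (intro sep) blast+
    qed (use C_nonneg[OF j] in auto)
    finally show ?thesis .
  qed
  note opt_nonneg = opt_time_nonneg[OF valid]
  have "pair_bound I \<le> (\<Sum>j\<in>jobs I. F j j) + (\<Sum>j\<in>jobs I. \<Sum>k<j. F j k + F k j)"
    unfolding pair_bound_def using opt_nonneg
    by (intro add_mono sum_mono) (auto simp: F_def min_def)
  also have "\<dots> = (\<Sum>j\<in>jobs I. \<Sum>k\<in>jobs I. F j k)"
    by (rule sum_square_pairs[symmetric])
  also have "\<dots> \<le> (\<Sum>j\<in>jobs I. C j)"
    by (intro sum_mono C_ge)
  finally show ?thesis
    by (simp add: cost_def C_def)
qed

text \<open>The infimum in \<open>opt\<close> is informative only over a nonempty set. The witness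
  runs all jobs untested in the order of their indices.\<close>

lemma feasible_exists:
  assumes "valid_problem I"
  shows "\<exists>\<sigma>. feasible I \<sigma>"
proof -
  let ?u = "upper_limit I"
  define \<sigma> :: schedule where
    "\<sigma> a = (case a of Exec_Untested j \<Rightarrow> if j \<in> jobs I then Some (\<Sum>i<j. ?u i) else None
       | _ \<Rightarrow> None)" for a
  have dom: "a \<in> dom \<sigma> \<longleftrightarrow> (\<exists>j\<in>jobs I. a = Exec_Untested j)" for a
    by (auto simp: \<sigma>_def split: task.splits if_splits)
  have u: "0 \<le> ?u j" if "j \<in> jobs I" for j
    using valid_problemD[OF assms] that by simp
  have mono: "(\<Sum>i<j. ?u i) + ?u j \<le> (\<Sum>i<k. ?u i)" if "j < k" "k \<in> jobs I" for j k
  proof -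
    have "(\<Sum>i<Suc j. ?u i) \<le> (\<Sum>i<k. ?u i)"
      using that u by (intro sum_mono2) auto
    then show ?thesis by simp
  qed
  have start: "the (\<sigma> (Exec_Untested j)) = (\<Sum>i<j. ?u i)" if "j \<in> jobs I" for j
    using that by (simp add: \<sigma>_def)
  have "0 \<le> the (\<sigma> a)" if a: "a \<in> dom \<sigma>" for a
  proof -
    obtain j where j: "j \<in> jobs I" "a = Exec_Untested j"
      using a dom by blast
    have "0 \<le> (\<Sum>i<j. ?u i)"
      using j by (intro sum_nonneg u) auto
    then show ?thesis
      unfolding j(2) start[OF j(1)] .
  qed
  moreover have "the (\<sigma> a) + duration I a \<le> the (\<sigma> b) \<or> the (\<sigma> b) + duration I b \<le> the (\<sigma> a)"
    if ab: "a \<in> dom \<sigma>" "b \<in> dom \<sigma>" "a \<noteq> b" for a b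
  proof -
    obtain j k where jk: "j \<in> jobs I" "k \<in> jobs I" "a = Exec_Untested j" "b = Exec_Untested k"
      using ab(1,2) dom by blast
    then have "j < k \<or> k < j"
      using ab(3) by auto
    then show ?thesis
      unfolding jk(3,4) start[OF jk(1)] start[OF jk(2)] duration.simps
      using mono jk(1,2) by blast
  qed
  moreover have "dom \<sigma> \<subseteq> (\<Union>j\<in>jobs I. {Test j, Exec j, Exec_Untested j})"
    using dom by blast
  moreover have "Exec_Untested j \<in> dom \<sigma> \<and> Test j \<notin> dom \<sigma> \<and> Exec j \<notin> dom \<sigma>"
    if "j \<in> jobs I" for j
    using that dom by blast
  ultimately have "feasible I \<sigma>"
    unfolding feasible_def by blast
  then show ?thesis by blast
qed

lemma opt_ge_pair_bound:
  assumes "valid_problem I"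
  shows "pair_bound I \<le> opt I"
  unfolding opt_def using feasible_exists[OF assms] feasible_cost_ge[OF assms]
  by (intro cInf_greatest) auto

section \<open>Runs of the priority queue\<close>

definition preceding :: "'a list \<Rightarrow> 'a \<Rightarrow> 'a set" where
  "preceding xs b = set (takeWhile (\<lambda>x. x \<noteq> b) xs)"

lemma preceding_Nil [simp]: "preceding [] b = {}"
  by (simp add: preceding_def)

lemma preceding_Cons [simp]:
  "preceding (x # xs) b = (if x = b then {} else insert x (preceding xs b))"
  by (cases "x = b") (simp_all add: preceding_def)

lemma preceding_subset: "preceding xs b \<subseteq> set xs"
  by (auto simp: preceding_def dest: set_takeWhileD)

lemma finite_preceding [simp]: "finite (preceding xs b)"
  by (simp add: preceding_def)

lemma not_preceding_self [simp]: "b \<notin> preceding xs b"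
  by (auto simp: preceding_def dest: set_takeWhileD)

lemma preceding_total:
  assumes "a \<in> set xs" "b \<in> set xs" "a \<noteq> b"
  shows "a \<in> preceding xs b \<longleftrightarrow> b \<notin> preceding xs a"
  using assms by (induction xs) auto

lemma preceding_trans:
  assumes "a \<in> preceding xs b" "b \<in> preceding xs c"
  shows "a \<in> preceding xs c"
  using assms
proof (induction xs)
  case (Cons x xs)
  then show ?case
    using preceding_subset[of xs c] by (auto split: if_splits)
qed simp

lemma dom_back_to_back: "dom (back_to_back I now xs) = set xs"
  by (induction xs arbitrary: now) auto

text \<open>There is no idle time, so a task starts once everything before it has run; distinctness
  allows this elapsed time to be a sum over a set.\<close>

lemma back_to_back_eq:
  assumes "distinct xs" "x \<in> set xs"
  shows "back_to_back I now xs x = Some (now + sum (duration I) (preceding xs x))"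
  using assms
proof (induction xs arbitrary: now)
  case (Cons y xs)
  show ?case
  proof (cases "x = y")
    case False
    moreover have "y \<notin> preceding xs x"
      using Cons.prems(1) preceding_subset[of xs x] by auto
    ultimately show ?thesis
      using Cons by (simp add: add.assoc)
  qed simp
qed simp

context
  fixes \<beta> :: real and I :: problem
begin

text \<open>Queues are sets, so a queue holding both \<open>Test j\<close> and \<open>Exec j\<close>
  could run \<open>Exec j\<close> twice or merge two copies of it. The hypothesis excludes this and
  is an invariant: \<open>Exec j\<close> enters exactly when \<open>Test j\<close> leaves.\<close>

lemma queue_run_set_distinct:
  assumes "queue_run \<beta> I Q xs" "\<And>j. Test j \<in> Q \<Longrightarrow> Exec j \<notin> Q"
  shows "set xs = Q \<union> \<Union>(released ` Q) \<and> distinct xs"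
  using assms
proof (induction rule: queue_run.induct)
  case empty
  then show ?case by simp
next
  case (step x Q xs)
  let ?Q = "Q - {x} \<union> released x"
  have "Exec j \<notin> ?Q" if "Test j \<in> ?Q" for j
    using that step.prems[of j] by (cases x) auto
  then have IH: "set xs = ?Q \<union> \<Union>(released ` ?Q)" "distinct xs"
    using step.IH by auto
  \<comment> \<open>Released tasks are executions, which release nothing further.\<close>
  have "\<Union>(released ` released x) = {}"
    by (cases x) auto
  then have eq: "set xs = (Q - {x}) \<union> released x \<union> \<Union>(released ` (Q - {x}))"
    unfolding IH(1) by auto
  have "x \<notin> released y" if "y \<in> Q" for y
    using that step.prems step.hyps(1) by (cases y) auto
  moreover have "x \<notin> released x"
    by (cases x) auto
  ultimately have "x \<notin> set xs"
    unfolding eq by auto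
  moreover have "set (x # xs) = Q \<union> \<Union>(released ` Q)"
    using step.hyps(1) by (auto simp: eq)
  ultimately show ?case
    using IH(2) by simp
qed

text \<open>While \<open>b\<close> waits in the queue, it competes with each task that is extracted,
  so none of these can be heavier.\<close>

lemma queue_run_weight_le:
  assumes "queue_run \<beta> I Q xs" "b \<in> Q" "a \<in> preceding xs b"
  shows "weight \<beta> I a \<le> weight \<beta> I b"
  using assms by (induction rule: queue_run.induct) (auto split: if_splits)

text \<open>\<open>Exec j\<close> waits in the queue only from the moment \<open>Test j\<close> has
  run; from then on the previous lemma applies to the rest of the run.\<close>

lemma queue_run_weight_le_Exec:
  assumes "queue_run \<beta> I Q xs" "Test j \<in> Q" "a \<in> preceding xs (Exec j)"
  shows "a \<in> preceding xs (Test j) \<or> a = Test j \<or> weight \<beta> I a \<le> weight \<beta> I (Exec j)"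
  using assms
proof (induction rule: queue_run.induct)
  case (step x Q xs)
  show ?case
  proof (cases "x = Test j")
    case True
    then show ?thesis
      using queue_run_weight_le[OF step.hyps(3), of "Exec j" a] step.prems by auto
  next
    case False
    then show ?thesis
      using step by (auto split: if_splits)
  qed
qed simp

lemma queue_run_Test_before_Exec:
  assumes "queue_run \<beta> I Q xs" "Test j \<in> Q" "Exec j \<notin> Q"
  shows "Test j \<in> preceding xs (Exec j)"
  using assms
proof (induction rule: queue_run.induct)
  case (step x Q xs)
  then show ?case by (cases x) auto
qed simp

end

section \<open>Mutual delays in a run of the algorithm\<close>

definition coin_cost :: "real \<Rightarrow> problem \<Rightarrow> nat \<Rightarrow> bool \<Rightarrow> real" where
  "coin_cost \<beta> I k b =
     (if b then max (2 * test_time I k + proc_time I k)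
          (max (\<beta> * test_time I k) ((1 + 1 / \<beta>) * (test_time I k + proc_time I k)))
      else (1 + 1 / \<beta>) * upper_limit I k)"

text \<open>The final task of \<open>j\<close> is inserted because \<open>preceding\<close> excludes
  it; this matters only for \<open>k = j\<close>.\<close>

definition work_before :: "problem \<Rightarrow> (nat \<Rightarrow> bool) \<Rightarrow> task list \<Rightarrow> nat \<Rightarrow> nat \<Rightarrow> real" where
  "work_before I c xs j k = sum (duration I)
     (job_tasks (c k) k \<inter> insert (final_task (c j) j) (preceding xs (final_task (c j) j)))"

text \<open>The choice depends on the instance alone and not on the coin flips, so each pair is
  charged to a fixed job and linearity of expectation applies.\<close>

definition cheaper :: "problem \<Rightarrow> nat \<Rightarrow> nat \<Rightarrow> nat" where
  "cheaper I j k = (if opt_time I j \<le> opt_time I k then j else k)"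

locale RPCP_run =
  fixes \<beta> :: real and I :: problem and c :: "nat \<Rightarrow> bool" and xs :: "task list"
  assumes beta_pos: "0 < \<beta>"
    and valid: "valid_problem I"
    and run: "queue_run \<beta> I (initial_queue I c) xs"
begin

lemma in_initial_queue [simp]:
  "Test j \<in> initial_queue I c \<longleftrightarrow> j \<in> jobs I \<and> c j"
  "Exec_Untested j \<in> initial_queue I c \<longleftrightarrow> j \<in> jobs I \<and> \<not> c j"
  "Exec j \<notin> initial_queue I c"
  by (auto simp: initial_queue_def split: if_splits)

lemma set_run: "set xs = (\<Union>k\<in>jobs I. job_tasks (c k) k)"
  and distinct_run: "distinct xs"
proof -
  have "set xs = initial_queue I c \<union> \<Union>(released ` initial_queue I c)"
    and d: "distinct xs"
    using queue_run_set_distinct[OF run] by auto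
  then have "set xs = initial_queue I c \<union> \<Union>(released ` initial_queue I c)" by simp
  also have "\<dots> = (\<Union>k\<in>jobs I. job_tasks (c k) k)"
    by (auto simp: initial_queue_def job_tasks_def split: if_splits)
  finally show "set xs = (\<Union>k\<in>jobs I. job_tasks (c k) k)" .
  show "distinct xs" by (rule d)
qed

lemma completion_time_run:
  assumes j: "j \<in> jobs I"
  shows "completion_time I (back_to_back I 0 xs) j = (\<Sum>k\<in>jobs I. work_before I c xs j k)"
proof -
  let ?f = "final_task (c j) j"
  let ?P = "insert ?f (preceding xs ?f)"
  \<comment> \<open>\<open>completion_time\<close> looks at the domain of the schedule, which has to
    agree with the coin flip.\<close>
  have mem: "Exec_Untested j \<in> set xs \<longleftrightarrow> \<not> c j"
    using j by (auto simp: set_run job_tasks_def split: if_splits)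
  have f: "?f \<in> set xs"
    using final_task_in_job_tasks j by (auto simp: set_run)
  have "completion_time I (back_to_back I 0 xs) j
      = the (back_to_back I 0 xs ?f) + duration I ?f"
    by (simp add: completion_time_def dom_back_to_back mem final_task_def)
  also have "\<dots> = sum (duration I) ?P"
    by (simp add: back_to_back_eq[OF distinct_run f])
  also have "?P = (\<Union>k\<in>jobs I. job_tasks (c k) k \<inter> ?P)"
    using preceding_subset[of xs ?f] f unfolding set_run by blast
  also have "sum (duration I) \<dots> = (\<Sum>k\<in>jobs I. work_before I c xs j k)"
    unfolding work_before_def
    by (rule sum.UNION_disjoint) (use job_tasks_disjoint in \<open>simp, simp, blast\<close>)
  finally show ?thesis .
qed

lemma work_before_self:
  assumes j: "j \<in> jobs I"
  shows "work_before I c xs j j = job_time I (c j) j"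
proof -
  have "Test j \<in> preceding xs (Exec j)" if "c j"
    using queue_run_Test_before_Exec[OF run] that j by simp
  then have "job_tasks (c j) j \<inter> insert (final_task (c j) j) (preceding xs (final_task (c j) j))
      = job_tasks (c j) j"
    by (auto simp: job_tasks_def final_task_def)
  then show ?thesis
    by (simp add: work_before_def sum_job_tasks)
qed

lemma work_before_other:
  assumes "j \<noteq> k"
  shows "work_before I c xs j k =
    (if c k then (if Test k \<in> preceding xs (final_task (c j) j) then test_time I k else 0)
               + (if Exec k \<in> preceding xs (final_task (c j) j) then proc_time I k else 0)
     else if Exec_Untested k \<in> preceding xs (final_task (c j) j) then upper_limit I k else 0)"
  using assms by (auto simp: work_before_def job_tasks_def final_task_def Int_insert_left)

lemma job_time_le_coin_cost:
  assumes j: "j \<in> jobs I"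
  shows "job_time I (c j) j \<le> coin_cost \<beta> I j (c j)"
proof -
  note valid_problemD[OF valid j]
  then show ?thesis
    using beta_pos by (auto simp: job_time_def coin_cost_def field_simps)
qed

text \<open>A task of \<open>j\<close> run while a task of \<open>k\<close> waits is at most as
  heavy as that task. This bounds the work on \<open>j\<close> before \<open>k\<close> completes by
  quantities of \<open>k\<close>; the work on \<open>k\<close> before \<open>j\<close> completes is
  bounded by the tasks of \<open>k\<close> themselves. A case analysis on the order of the tasks
  gives the terms of \<open>coin_cost\<close>.\<close>

lemma pair_le_coin_cost:
  assumes j: "j \<in> jobs I" and k: "k \<in> jobs I" and ne: "j \<noteq> k"
  shows "work_before I c xs j k + work_before I c xs k j \<le> coin_cost \<beta> I k (c k)"
proof -
  let ?pre = "preceding xs"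
  define tj pj uj tk pk uk where defs: "tj = test_time I j" "pj = proc_time I j"
    "uj = upper_limit I j" "tk = test_time I k" "pk = proc_time I k" "uk = upper_limit I k"
  have nn: "0 \<le> tj" "0 \<le> pj" "0 \<le> uj" "0 \<le> tk" "0 \<le> pk" "0 \<le> uk"
    using valid_problemD[OF valid j] valid_problemD[OF valid k] by (simp_all add: defs)
  have total: "a \<in> ?pre b \<longleftrightarrow> b \<notin> ?pre a"
    if "a \<in> job_tasks (c j) j" "b \<in> job_tasks (c k) k" for a b
    using that j k ne job_tasks_disjoint[OF ne] by (intro preceding_total) (auto simp: set_run)
  note weight_le = queue_run_weight_le[OF run]
  note weight_le_Exec = queue_run_weight_le_Exec[OF run]
  \<comment> \<open>A test has weight \<beta> times its length, so a test that goes first is bounded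
    by the competing weight divided by \<beta>. This is the source of the factor
    \<open>1 + 1 / \<beta>\<close>.\<close>
  have div: "x \<le> y / \<beta>" if "\<beta> * x \<le> y" for x y
    using that beta_pos by (simp add: field_simps)
  have inv: "(1 + 1 / \<beta>) * y = y + y / \<beta>" for y
    by (simp add: field_simps)
  have div_nn: "0 \<le> y / \<beta>" if "0 \<le> y" for y
    using that beta_pos by simp
  note wb = work_before_other[OF ne] work_before_other[OF ne[symmetric]]
  have TE: "Test i \<in> ?pre (Exec i)" if "i \<in> jobs I" "c i" for i
    using queue_run_Test_before_Exec[OF run] that by simp
  show ?thesis
  proof (cases "c j"; cases "c k")
    assume c: "\<not> c j" "\<not> c k"
    have "Exec_Untested j \<in> ?pre (Exec_Untested k) \<Longrightarrow> uj \<le> uk"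
      using weight_le[of "Exec_Untested k" "Exec_Untested j"] k c by (simp add: defs)
    then show ?thesis
      using c total[of "Exec_Untested j" "Exec_Untested k"] nn div_nn[OF nn(6)]
      by (auto simp: wb coin_cost_def final_task_def job_tasks_def inv simp flip: defs)
  next
    \<comment> \<open>If \<open>j\<close> completes first, it costs at most \<open>uk\<close>.
      Otherwise \<open>k\<close> costs \<open>uk\<close> and at most the test of \<open>j\<close> is
      added, which is bounded by \<open>uk / \<beta>\<close>.\<close>
    assume c: "c j" "\<not> c k"
    have 1: "Test j \<in> ?pre (Exec_Untested k) \<Longrightarrow> tj \<le> uk / \<beta>"
      using weight_le[of "Exec_Untested k" "Test j"] k c div by (simp add: defs)
    have 2: "Exec j \<in> ?pre (Exec_Untested k) \<Longrightarrow> tj + pj \<le> uk"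
      using weight_le[of "Exec_Untested k" "Exec j"] k c by (simp add: defs)
    show ?thesis
      using c total[of "Exec j" "Exec_Untested k"] nn div_nn[OF nn(6)] 1 2
      by (auto simp: wb coin_cost_def final_task_def job_tasks_def inv simp flip: defs)
  next
    \<comment> \<open>If \<open>j\<close> runs before the test of \<open>k\<close>, the bound is
      \<open>\<beta> * tk\<close>; between test and execution of \<open>k\<close>, it is
      \<open>tk + (tk + pk)\<close>; afterwards only \<open>tk + pk\<close> is spent.\<close>
    assume c: "\<not> c j" "c k"
    have 1: "Exec_Untested j \<in> ?pre (Test k) \<Longrightarrow> uj \<le> \<beta> * tk"
      using weight_le[of "Test k" "Exec_Untested j"] k c by (simp add: defs)
    have 2: "Exec_Untested j \<in> ?pre (Exec k) \<Longrightarrow> Exec_Untested j \<notin> ?pre (Test k) \<Longrightarrow> uj \<le> tk + pk"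
      using weight_le_Exec[of k "Exec_Untested j"] k c by (simp add: defs)
    have 3: "Test k \<in> ?pre (Exec_Untested j) \<longleftrightarrow> Exec_Untested j \<notin> ?pre (Test k)"
      "Exec k \<in> ?pre (Exec_Untested j) \<longleftrightarrow> Exec_Untested j \<notin> ?pre (Exec k)"
      using total[of "Exec_Untested j" "Test k"] total[of "Exec_Untested j" "Exec k"] c
      by (auto simp: job_tasks_def)
    have 4: "Exec_Untested j \<in> ?pre (Test k) \<Longrightarrow> Exec_Untested j \<in> ?pre (Exec k)"
      using preceding_trans TE[OF k c(2)] by metis
    show ?thesis
      using c nn 1 2 3 4
      by (auto simp: wb coin_cost_def final_task_def le_max_iff_disj simp flip: defs)
  next
    \<comment> \<open>If \<open>j\<close> completes before the test of \<open>k\<close>, the bound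
      is \<open>\<beta> * tk\<close>; if between test and execution of \<open>k\<close>, it is
      \<open>tk + (tk + pk)\<close>. If \<open>k\<close> completes first, \<open>tk + pk\<close> is
      increased by at most \<open>tj\<close>, which is at most \<open>tk\<close> when
      \<open>j\<close> is tested before \<open>k\<close> and at most
      \<open>(tk + pk) / \<beta>\<close> when it is tested later.\<close>
    assume c: "c j" "c k"
    have TTj: "Test j \<in> ?pre (Test k) \<Longrightarrow> tj \<le> tk"
      using weight_le[of "Test k" "Test j"] k c beta_pos by (simp add: defs)
    have EjTk: "Exec j \<in> ?pre (Test k) \<Longrightarrow> tj + pj \<le> \<beta> * tk"
      using weight_le[of "Test k" "Exec j"] k c by (simp add: defs)
    have TjEk: "Test j \<in> ?pre (Exec k) \<Longrightarrow> Test j \<notin> ?pre (Test k) \<Longrightarrow> tj \<le> (tk + pk) / \<beta>"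
      using weight_le_Exec[of k "Test j"] k c ne by (auto simp: defs intro: div)
    have EjEk: "Exec j \<in> ?pre (Exec k) \<Longrightarrow> Exec j \<notin> ?pre (Test k) \<Longrightarrow> tj + pj \<le> tk + pk"
      using weight_le_Exec[of k "Exec j"] k c by (auto simp: defs)
    have tot: "Test k \<in> ?pre (Exec j) \<longleftrightarrow> Exec j \<notin> ?pre (Test k)"
      "Exec k \<in> ?pre (Exec j) \<longleftrightarrow> Exec j \<notin> ?pre (Exec k)"
      using total[of "Exec j" "Test k"] total[of "Exec j" "Exec k"] c
      by (auto simp: job_tasks_def)
    have tr: "Exec j \<in> ?pre (Test k) \<Longrightarrow> Exec j \<in> ?pre (Exec k)"
      "Exec j \<in> ?pre (Exec k) \<Longrightarrow> Test j \<in> ?pre (Exec k)"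
      using preceding_trans TE[OF k c(2)] TE[OF j c(1)] by metis+
    show ?thesis
      using c nn TTj EjTk TjEk EjEk tot tr div_nn[of "tk + pk"]
      by (auto simp: wb coin_cost_def final_task_def le_max_iff_disj inv simp flip: defs)
  qed
qed

lemma cost_run_le:
  "cost I (back_to_back I 0 xs) \<le> (\<Sum>j\<in>jobs I. coin_cost \<beta> I j (c j))
     + (\<Sum>j\<in>jobs I. \<Sum>k<j. coin_cost \<beta> I (cheaper I j k) (c (cheaper I j k)))"
proof -
  have "cost I (back_to_back I 0 xs) = (\<Sum>j\<in>jobs I. \<Sum>k\<in>jobs I. work_before I c xs j k)"
    by (simp add: cost_def completion_time_run)
  also have "\<dots> = (\<Sum>j\<in>jobs I. work_before I c xs j j)
     + (\<Sum>j\<in>jobs I. \<Sum>k<j. work_before I c xs j k + work_before I c xs k j)"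
    by (rule sum_square_pairs)
  also have "\<dots> \<le> (\<Sum>j\<in>jobs I. coin_cost \<beta> I j (c j))
     + (\<Sum>j\<in>jobs I. \<Sum>k<j. coin_cost \<beta> I (cheaper I j k) (c (cheaper I j k)))"
  proof (intro add_mono sum_mono)
    fix j assume "j \<in> jobs I"
    then show "work_before I c xs j j \<le> coin_cost \<beta> I j (c j)"
      by (simp add: work_before_self job_time_le_coin_cost)
  next
    fix j k assume "j \<in> jobs I" "k \<in> {..<j}"
    then show "work_before I c xs j k + work_before I c xs k j
        \<le> coin_cost \<beta> I (cheaper I j k) (c (cheaper I j k))"
      using pair_le_coin_cost[of j k] pair_le_coin_cost[of k j]
      by (auto simp: cheaper_def add.commute)
  qed
  finally show ?thesis .
qed

end

section \<open>Taking expectations\<close>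

definition expected_coin_cost :: "real \<Rightarrow> problem \<Rightarrow> nat \<Rightarrow> real" where
  "expected_coin_cost \<beta> I k =
     coin_cost \<beta> I k True * test_prob \<beta> I k + coin_cost \<beta> I k False * (1 - test_prob \<beta> I k)"

lemma job_ratio_eq: "job_ratio \<beta> I k = expected_coin_cost \<beta> I k / opt_time I k"
  by (simp add: job_ratio_def expected_coin_cost_def coin_cost_def add.commute)

text \<open>Only the coin of job \<open>k\<close> matters, and the marginal of the product
  distribution at \<open>k\<close> is Bernoulli.\<close>

lemma expectation_coin_cost:
  assumes "k \<in> jobs I" "0 \<le> test_prob \<beta> I k" "test_prob \<beta> I k \<le> 1"
  shows "measure_pmf.expectation
      (Pi_pmf (jobs I) False (\<lambda>j. bernoulli_pmf (test_prob \<beta> I j)))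
      (\<lambda>c. coin_cost \<beta> I k (c k)) = expected_coin_cost \<beta> I k"
proof -
  let ?P = "Pi_pmf (jobs I) False (\<lambda>j. bernoulli_pmf (test_prob \<beta> I j))"
  have "measure_pmf.expectation ?P (\<lambda>c. coin_cost \<beta> I k (c k))
      = measure_pmf.expectation (map_pmf (\<lambda>c. c k) ?P) (coin_cost \<beta> I k)"
    by simp
  also have "map_pmf (\<lambda>c. c k) ?P = bernoulli_pmf (test_prob \<beta> I k)"
    using assms(1) by (simp add: Pi_pmf_component)
  finally show ?thesis
    using assms(2,3) by (simp add: expected_coin_cost_def mult.commute)
qed

text \<open>The hypothesis on \<open>R\<close> is stated as a product, so that jobs with optimal
  time zero need no separate treatment here.\<close>

lemma expected_cost_le:
  assumes beta: "0 < \<beta>" and A: "is_RPCP \<beta> A" and I: "I \<in> RPCP_problems \<beta>"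
    and R: "\<And>k. k \<in> jobs I \<Longrightarrow> expected_coin_cost \<beta> I k \<le> R * opt_time I k"
  shows "expected_cost \<beta> A I \<le> R * pair_bound I"
proof -
  let ?P = "Pi_pmf (jobs I) False (\<lambda>j. bernoulli_pmf (test_prob \<beta> I j))"
  have valid: "valid_problem I"
    and prob: "\<And>k. k \<in> jobs I \<Longrightarrow> 0 \<le> test_prob \<beta> I k \<and> test_prob \<beta> I k \<le> 1"
    using I by (auto simp: RPCP_problems_def)
  have runs: "RPCP_run \<beta> I c (A I c)" for c
    using beta valid A by unfold_locales (auto simp: is_RPCP_def)
  \<comment> \<open>With finitely many coins the support is finite, and every real function is
    integrable.\<close>
  have "finite (set_pmf ?P)"
    by (simp add: set_Pi_pmf finite_PiE_dflt)
  then have int: "integrable (measure_pmf ?P) f" for f :: "(nat \<Rightarrow> bool) \<Rightarrow> real"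
    by (rule integrable_measure_pmf_finite)
  note coin = expectation_coin_cost[OF _ conjunct1[OF prob] conjunct2[OF prob]]
  have m_job: "cheaper I j k \<in> jobs I" if "j \<in> jobs I" "k < j" for j k
    using that by (auto simp: cheaper_def)
  have "expected_cost \<beta> A I \<le> measure_pmf.expectation ?P
      (\<lambda>c. (\<Sum>j\<in>jobs I. coin_cost \<beta> I j (c j))
         + (\<Sum>j\<in>jobs I. \<Sum>k<j. coin_cost \<beta> I (cheaper I j k) (c (cheaper I j k))))"
    unfolding expected_cost_def
    by (intro integral_mono int RPCP_run.cost_run_le[OF runs])
  also have "\<dots> = (\<Sum>j\<in>jobs I. expected_coin_cost \<beta> I j)
      + (\<Sum>j\<in>jobs I. \<Sum>k<j. expected_coin_cost \<beta> I (cheaper I j k))"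
    unfolding Bochner_Integration.integral_add[OF int int] Bochner_Integration.integral_sum[OF int]
    by (intro arg_cong2[where f = "(+)"] sum.cong refl coin m_job) auto
  also have "\<dots> \<le> (\<Sum>j\<in>jobs I. R * opt_time I j)
      + (\<Sum>j\<in>jobs I. \<Sum>k<j. R * min (opt_time I j) (opt_time I k))"
  proof (intro add_mono sum_mono)
    fix j k assume "j \<in> jobs I" "k \<in> {..<j}"
    then show "expected_coin_cost \<beta> I (cheaper I j k) \<le> R * min (opt_time I j) (opt_time I k)"
      using R[OF m_job[of j k]]
      by (auto simp: cheaper_def min_def split: if_splits)
  qed (rule R)
  also have "\<dots> = R * pair_bound I"
    by (simp add: pair_bound_def distrib_left sum_distrib_left)
  finally show ?thesis .
qed

lemma expected_coin_cost_nonneg: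
  assumes "0 < \<beta>" "I \<in> RPCP_problems \<beta>" "k \<in> jobs I"
  shows "0 \<le> expected_coin_cost \<beta> I k"
proof -
  have valid: "valid_problem I" and "0 \<le> test_prob \<beta> I k" "test_prob \<beta> I k \<le> 1"
    using assms(2,3) by (auto simp: RPCP_problems_def)
  then show ?thesis
    using assms(1) valid_problemD[OF valid assms(3)] by (auto simp: expected_coin_cost_def coin_cost_def le_max_iff_disj)
qed

text \<open>Only a vanishing denominator needs care. As testing times are positive, it forces an
  upper limit of zero; then the ratio is below one, the job is never tested, and its expected cost
  is zero as well.\<close>

lemma expected_coin_cost_eq:
  assumes "I \<in> RPCP_problems \<beta>" "k \<in> jobs I"
  shows "expected_coin_cost \<beta> I k = job_ratio \<beta> I k * opt_time I k"
proof (cases "opt_time I k = 0")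
  case True
  have "0 < test_time I k" "0 \<le> proc_time I k"
    using assms by (auto simp: RPCP_problems_def valid_problem_def)
  then have "upper_limit I k = 0"
    using True by (auto simp: opt_time_def min_def split: if_splits)
  then show ?thesis
    using True by (simp add: expected_coin_cost_def coin_cost_def test_prob_def ratio_def
        test_prob_of_ratio_def)
qed (simp add: job_ratio_eq)

section \<open>From single instances to the competitive ratio\<close>

theorem theorem12:
  fixes \<beta> :: real
    and A :: "problem \<Rightarrow> (nat \<Rightarrow> bool) \<Rightarrow> task list"
  assumes "\<beta> > 0"
    and "is_RPCP \<beta> A"
  shows "(\<forall>I\<in>RPCP_problems \<beta>.
            expected_cost \<beta> A I \<le> (MAX k\<in>jobs I. job_ratio \<beta> I k) * opt I) \<and>
         expected_competitive_ratio (expected_cost \<beta> A) (RPCP_problems \<beta>)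
           \<le> (SUP I\<in>RPCP_problems \<beta>. ereal (MAX k\<in>jobs I. job_ratio \<beta> I k))"
proof -
  let ?R = "\<lambda>I. MAX k\<in>jobs I. job_ratio \<beta> I k"
  have bounds: "expected_cost \<beta> A I \<le> ?R I * opt I" "0 \<le> opt I"
    if I: "I \<in> RPCP_problems \<beta>" for I
  proof -
    have valid: "valid_problem I"
      using I by (simp add: RPCP_problems_def)
    note opt_time = opt_time_nonneg[OF valid]
    have le: "job_ratio \<beta> I k \<le> ?R I" if "k \<in> jobs I" for k
      using that by (intro Max_ge) auto
    have zero: "0 \<in> jobs I"
      using valid by (simp add: valid_problem_def)
    \<comment> \<open>Job 0 exists since there is at least one job. Nonnegativity of the maximum is
      what allows \<open>pair_bound I\<close> to be replaced by the larger
      \<open>opt I\<close>.\<close>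
    have "0 \<le> job_ratio \<beta> I 0"
      using expected_coin_cost_nonneg[OF assms(1) I zero] opt_time[OF zero]
      by (simp add: job_ratio_eq)
    then have R: "0 \<le> ?R I"
      using le[OF zero] by linarith
    have "expected_cost \<beta> A I \<le> ?R I * pair_bound I"
      using le opt_time expected_coin_cost_eq[OF I]
      by (intro expected_cost_le[OF assms I]) (auto intro: mult_right_mono)
    also have "\<dots> \<le> ?R I * opt I"
      by (intro mult_left_mono opt_ge_pair_bound valid R)
    finally show "expected_cost \<beta> A I \<le> ?R I * opt I" .
    have "0 \<le> pair_bound I"
      unfolding pair_bound_def using opt_time
      by (intro add_nonneg_nonneg sum_nonneg) auto
    then show "0 \<le> opt I"
      using opt_ge_pair_bound[OF valid] by linarith
  qed
  \<comment> \<open>The supremum lies in the extended reals, so it needs no finiteness; monotonicity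
    of the product uses that \<open>opt I\<close> is nonnegative. Hence the supremum is one of the
    factors over which the competitive ratio is the infimum.\<close>
  have "ereal (expected_cost \<beta> A I) \<le> (SUP I\<in>RPCP_problems \<beta>. ereal (?R I)) * ereal (opt I)"
    if I: "I \<in> RPCP_problems \<beta>" for I
  proof -
    have "ereal (expected_cost \<beta> A I) \<le> ereal (?R I) * ereal (opt I)"
      using bounds(1)[OF I] by simp
    also have "\<dots> \<le> (SUP I\<in>RPCP_problems \<beta>. ereal (?R I)) * ereal (opt I)"
      using bounds(2)[OF I] I by (intro ereal_mult_right_mono SUP_upper) auto
    finally show ?thesis .
  qed
  then show ?thesis
    using bounds(1) unfolding expected_competitive_ratio_def
    by (intro conjI ballI Inf_lower) auto
qed

end
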